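(* Let $G$ be a parity game and $\mathcal M=(M,<,\bot,\top,\upharpoonright,+)$ a regress measure space with canonical truncation operator satisfying $\bot\upharpoonright_v=\bot$ for every position $v$ of odd priority. Let $\mu:V\to M$ be a simple quasi-dominion measure (i.e. both a simple measure function and a quasi-dominion measure). Then $D_+(\mu)$ is a quasi 0-dominion, and every $\mu$-coherent 0-strategy that is winning on $D_0(\mu)$ is, once restricted to $D_+(\mu)$, a 0-witness for it.
   Context: Parity game: finite disjoint $V_0,V_1$ (positions of players 0,1), $V=V_0\cup V_1$, move relation $E\subseteq V\times V$ with $E(v)=\{w:(v,w)\in E\}\neq\emptyset$ for all $v$, priority function $p:V\to P$, $P\subset\mathbb{N}$ finite. A positional $\alpha$-strategy on $U\subseteq V$ is $\sigma:U\cap V_\alpha\to V$ with $(v,\sigma(v))\in E$ (restriction to $U$ restricts its domain to $U\cap V_\alpha$). For strategies $\sigma_0,\sigma_1$ on $U$ and $v\in U$, the play from $v$ in $U$ is the maximal finite or infinite sequence of positions of $U$ starting at $v$ whose successor at a $V_\alpha$ position is given by $\sigma_\alpha$ (it stops when the prescribed successor lies outside $U$). The priority of a finite nonempty path is its maximal priority; of an infinite play, the maximal priority occurring infinitely often. $U$ is a 0-dominion if some 0-strategy on $U$ ensures that for every 1-strategy on $U$ and $v\in U$ the play is infinite with even priority; a 0-strategy is winning on $U$ if its restriction to $U$ is such. $Q$ is a quasi 0-dominion if there is a 0-strategy on $Q$ (a 0-witness) such that for every 1-strategy on $Q$ and every $v\in Q$, the induced play in $Q$ (finite or infinite) has even priority.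 Measure space $(M,<,\bot,\top,\upharpoonright,+)$: $<$ strict total order on $M$ with min $\bot$, max $\top$; truncation $\upharpoonright:M\times V\to M$; stretch $+:M\times V\to M$. Truncation canonical: $\eta=\top$ iff $\eta\upharpoonright_v=\top$, and monotone in $\eta$. Regress measure space: (1) $(\eta+v)\upharpoonright_v<\eta\upharpoonright_v$ if $\bot<\eta\upharpoonright_v<\top$ and $p(v)$ odd; (2) $(\eta+v)\upharpoonright_u\le\eta\upharpoonright_u$ for all odd-priority $u$ with $p(v)\le p(u)$. For $\mu:V\to M$: $D_0(\mu)=\{v:\mu(v)\upharpoonright_v=\top\}$, $D_\bot(\mu)=\{v:\mu(v)\upharpoonright_v=\bot\}$, $D_+(\mu)=V\setminus D_\bot(\mu)$. Regress measure: for all $v\in D_+(\mu)\setminus D_0(\mu)$, if $v\in V_0$ then $\mu(v)\le\mu(w)+v$ for some $w\in E(v)$, if $v\in V_1$ then for all $w\in E(v)$. Quasi-dominion measure: regress measure with $D_0(\mu)$ a 0-dominion. Measure of a finite path: $\mathrm{msr}(\varepsilon)=\bot$, $\mathrm{msr}(v\cdot\pi')=\mathrm{msr}(\pi')+v$; $S(v,X)=\{\mathrm{msr}(\pi):\pi$ finite simple path from $v$ with all positions in $X$, empty path included$\}\cup\{\top\}$; simple measure function: $\mu(v)\in S(v,D_+(\mu))$ for all $v$. A 0-strategy $\sigma$ is $\mu$-coherent if $\mu(v)\le\mu(\sigma(v))+v$ for all $v\in V_0$. *)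

theory Defs
  imports "HOL-Library.FuncSet"
begin

section \<open>Parity games\<close>

record 'v parity_game =
  pos0 :: "'v set"
  pos1 :: "'v set"
  moves :: "('v \<times> 'v) set"
  prio :: "'v \<Rightarrow> nat"

definition pos :: "'v parity_game \<Rightarrow> 'v set" where
  "pos G = pos0 G \<union> pos1 G"

definition succs :: "'v parity_game \<Rightarrow> 'v \<Rightarrow> 'v set" where
  "succs G v = {w. (v, w) \<in> moves G}"

text \<open>The finite set of priorities is the image of \<open>pos G\<close> under \<open>prio G\<close>; the values of
  \<open>prio G\<close> outside \<open>pos G\<close> are never used.\<close>

definition is_parity_game :: "'v parity_game \<Rightarrow> bool" where
  "is_parity_game G \<longleftrightarrow>
     finite (pos0 G) \<and> finite (pos1 G) \<and> pos0 G \<inter> pos1 G = {} \<and>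
     moves G \<subseteq> pos G \<times> pos G \<and> (\<forall>v\<in>pos G. succs G v \<noteq> {})"

text \<open>Positional strategies on \<open>U\<close> are extensional functions on \<open>U \<inter> pos0 G\<close> or
  \<open>U \<inter> pos1 G\<close>.  Their moves may leave \<open>U\<close>.\<close>

definition strategies0 :: "'v parity_game \<Rightarrow> 'v set \<Rightarrow> ('v \<Rightarrow> 'v) set" where
  "strategies0 G U = (\<Pi>\<^sub>E v\<in>U \<inter> pos0 G. succs G v)"

definition strategies1 :: "'v parity_game \<Rightarrow> 'v set \<Rightarrow> ('v \<Rightarrow> 'v) set" where
  "strategies1 G U = (\<Pi>\<^sub>E v\<in>U \<inter> pos1 G. succs G v)"

definition restrict0 :: "'v parity_game \<Rightarrow> ('v \<Rightarrow> 'v) \<Rightarrow> 'v set \<Rightarrow> ('v \<Rightarrow> 'v)" where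
  "restrict0 G \<sigma> U = restrict \<sigma> (U \<inter> pos0 G)"

subsection \<open>Plays and their priorities\<close>

datatype 'v play = Finite "'v list" | is_infinite: Infinite "nat \<Rightarrow> 'v"

definition next_pos :: "'v parity_game \<Rightarrow> ('v \<Rightarrow> 'v) \<Rightarrow> ('v \<Rightarrow> 'v) \<Rightarrow> 'v \<Rightarrow> 'v" where
  "next_pos G \<sigma>0 \<sigma>1 v = (if v \<in> pos0 G then \<sigma>0 v else \<sigma>1 v)"

text \<open>A finite play consists of the positions strictly before the first exit from \<open>U\<close>, so
  only iterates up to and including that exit matter; the strategies are unspecified
  outside \<open>U\<close>.\<close>

definition play_in ::
  "'v parity_game \<Rightarrow> 'v set \<Rightarrow> ('v \<Rightarrow> 'v) \<Rightarrow> ('v \<Rightarrow> 'v) \<Rightarrow> 'v \<Rightarrow> 'v play" where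
  "play_in G U \<sigma>0 \<sigma>1 v =
     (let \<rho> = (\<lambda>n. (next_pos G \<sigma>0 \<sigma>1 ^^ n) v)
      in if \<forall>n. \<rho> n \<in> U then Infinite \<rho>
         else Finite (map \<rho> [0..<(LEAST n. \<rho> n \<notin> U)]))"

fun play_prio :: "'v parity_game \<Rightarrow> 'v play \<Rightarrow> nat" where
  "play_prio G (Finite \<pi>) = Max (prio G ` set \<pi>)"
| "play_prio G (Infinite \<rho>) = Max {k. infinite {n. prio G (\<rho> n) = k}}"

subsection \<open>Dominions and quasi dominions of player 0\<close>

definition dominion0_witness :: "'v parity_game \<Rightarrow> 'v set \<Rightarrow> ('v \<Rightarrow> 'v) \<Rightarrow> bool" where
  "dominion0_witness G U \<sigma> \<longleftrightarrow> \<sigma> \<in> strategies0 G U \<and>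
     (\<forall>\<tau>\<in>strategies1 G U. \<forall>v\<in>U.
        is_infinite (play_in G U \<sigma> \<tau> v) \<and> even (play_prio G (play_in G U \<sigma> \<tau> v)))"

definition dominion0 :: "'v parity_game \<Rightarrow> 'v set \<Rightarrow> bool" where
  "dominion0 G U \<longleftrightarrow> U \<subseteq> pos G \<and> (\<exists>\<sigma>. dominion0_witness G U \<sigma>)"

definition winning0_on :: "'v parity_game \<Rightarrow> ('v \<Rightarrow> 'v) \<Rightarrow> 'v set \<Rightarrow> bool" where
  "winning0_on G \<sigma> U \<longleftrightarrow> dominion0_witness G U (restrict0 G \<sigma> U)"

definition quasi_dominion0_witness :: "'v parity_game \<Rightarrow> 'v set \<Rightarrow> ('v \<Rightarrow> 'v) \<Rightarrow> bool" where
  "quasi_dominion0_witness G Q \<sigma> \<longleftrightarrow> \<sigma> \<in> strategies0 G Q \<and>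
     (\<forall>\<tau>\<in>strategies1 G Q. \<forall>v\<in>Q. even (play_prio G (play_in G Q \<sigma> \<tau> v)))"

definition quasi_dominion0 :: "'v parity_game \<Rightarrow> 'v set \<Rightarrow> bool" where
  "quasi_dominion0 G Q \<longleftrightarrow> Q \<subseteq> pos G \<and> (\<exists>\<sigma>. quasi_dominion0_witness G Q \<sigma>)"

section \<open>Measure spaces\<close>

text \<open>The strict total order with minimum and maximum is given by the type class constraints
  on \<open>'m\<close>; minimum and maximum are allowed to coincide.\<close>

record ('m, 'v) measure_ops =
  trunc :: "'m \<Rightarrow> 'v \<Rightarrow> 'm"
  stretch :: "'m \<Rightarrow> 'v \<Rightarrow> 'm"

definition canonical_truncation ::
  "'v parity_game \<Rightarrow> ('m :: {linorder, order_bot, order_top}, 'v) measure_ops \<Rightarrow> bool" where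
  "canonical_truncation G M \<longleftrightarrow>
     (\<forall>v\<in>pos G. (\<forall>\<eta>. \<eta> = top \<longleftrightarrow> trunc M \<eta> v = top) \<and> mono (\<lambda>\<eta>. trunc M \<eta> v))"

definition regress_measure_space ::
  "'v parity_game \<Rightarrow> ('m :: {linorder, order_bot, order_top}, 'v) measure_ops \<Rightarrow> bool" where
  "regress_measure_space G M \<longleftrightarrow>
     (\<forall>\<eta>. \<forall>v\<in>pos G. bot < trunc M \<eta> v \<and> trunc M \<eta> v < top \<and> odd (prio G v) \<longrightarrow>
        trunc M (stretch M \<eta> v) v < trunc M \<eta> v) \<and>
     (\<forall>\<eta>. \<forall>v\<in>pos G. \<forall>u\<in>pos G. odd (prio G u) \<and> prio G v \<le> prio G u \<longrightarrow>
        trunc M (stretch M \<eta> v) u \<le> trunc M \<eta> u)"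

section \<open>Measure functions\<close>

definition D_zero ::
  "'v parity_game \<Rightarrow> ('m :: {linorder, order_bot, order_top}, 'v) measure_ops
     \<Rightarrow> ('v \<Rightarrow> 'm) \<Rightarrow> 'v set" where
  "D_zero G M \<mu> = {v \<in> pos G. trunc M (\<mu> v) v = top}"

definition D_bot ::
  "'v parity_game \<Rightarrow> ('m :: {linorder, order_bot, order_top}, 'v) measure_ops
     \<Rightarrow> ('v \<Rightarrow> 'm) \<Rightarrow> 'v set" where
  "D_bot G M \<mu> = {v \<in> pos G. trunc M (\<mu> v) v = bot}"

definition D_plus ::
  "'v parity_game \<Rightarrow> ('m :: {linorder, order_bot, order_top}, 'v) measure_ops
     \<Rightarrow> ('v \<Rightarrow> 'm) \<Rightarrow> 'v set" where
  "D_plus G M \<mu> = pos G - D_bot G M \<mu>"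

definition regress_measure ::
  "'v parity_game \<Rightarrow> ('m :: {linorder, order_bot, order_top}, 'v) measure_ops
     \<Rightarrow> ('v \<Rightarrow> 'm) \<Rightarrow> bool" where
  "regress_measure G M \<mu> \<longleftrightarrow>
     (\<forall>v \<in> D_plus G M \<mu> - D_zero G M \<mu>.
        (v \<in> pos0 G \<longrightarrow> (\<exists>w\<in>succs G v. \<mu> v \<le> stretch M (\<mu> w) v)) \<and>
        (v \<in> pos1 G \<longrightarrow> (\<forall>w\<in>succs G v. \<mu> v \<le> stretch M (\<mu> w) v)))"

definition quasi_dominion_measure ::
  "'v parity_game \<Rightarrow> ('m :: {linorder, order_bot, order_top}, 'v) measure_ops
     \<Rightarrow> ('v \<Rightarrow> 'm) \<Rightarrow> bool" where
  "quasi_dominion_measure G M \<mu> \<longleftrightarrow>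
     regress_measure G M \<mu> \<and> dominion0 G (D_zero G M \<mu>)"

primrec msr ::
  "('m :: {linorder, order_bot, order_top}, 'v) measure_ops \<Rightarrow> 'v list \<Rightarrow> 'm" where
  "msr M [] = bot"
| "msr M (v # \<pi>) = stretch M (msr M \<pi>) v"

definition simple_paths :: "'v parity_game \<Rightarrow> 'v \<Rightarrow> 'v set \<Rightarrow> 'v list set" where
  "simple_paths G v X =
     {\<pi>. (\<pi> = [] \<or> hd \<pi> = v) \<and> set \<pi> \<subseteq> X \<and> distinct \<pi> \<and>
         successively (\<lambda>x y. (x, y) \<in> moves G) \<pi>}"

definition simple_measures ::
  "'v parity_game \<Rightarrow> ('m :: {linorder, order_bot, order_top}, 'v) measure_ops
     \<Rightarrow> 'v \<Rightarrow> 'v set \<Rightarrow> 'm set" where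
  "simple_measures G M v X = msr M ` simple_paths G v X \<union> {top}"

definition simple_measure_function ::
  "'v parity_game \<Rightarrow> ('m :: {linorder, order_bot, order_top}, 'v) measure_ops
     \<Rightarrow> ('v \<Rightarrow> 'm) \<Rightarrow> bool" where
  "simple_measure_function G M \<mu> \<longleftrightarrow>
     (\<forall>v\<in>pos G. \<mu> v \<in> simple_measures G M v (D_plus G M \<mu>))"

definition coherent ::
  "'v parity_game \<Rightarrow> ('m :: {linorder, order_bot, order_top}, 'v) measure_ops
     \<Rightarrow> ('v \<Rightarrow> 'm) \<Rightarrow> ('v \<Rightarrow> 'v) \<Rightarrow> bool" where
  "coherent G M \<mu> \<sigma> \<longleftrightarrow> (\<forall>v\<in>pos0 G. \<mu> v \<le> stretch M (\<mu> (\<sigma> v)) v)"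

end

theory Submission
  imports Defs "HOL-Library.Infinite_Set"
begin

text \<open>Truncating at an odd position \<open>u\<close> of priority at least that of the
  positions traversed, the measures are nondecreasing along a coherent play outside \<open>D_zero\<close>,
  and they strictly increase whenever \<open>u\<close> itself is left. So an odd \<open>u\<close> cannot dominate an infinite play,
  where it would recur. A finite play ends by leaving \<open>D_plus\<close>, and simplicity of \<open>\<mu>\<close> forces the
  measure of the exit position to be \<open>bot\<close>; hence an odd dominating \<open>u\<close> would have measure
  truncated to \<open>bot\<close>. Plays that enter \<open>D_zero\<close> never leave it again.\<close>

section \<open>Priorities of infinite plays\<close>

text \<open>Finitely many priorities make the \<open>Max\<close> in \<open>play_prio\<close> range
  over a finite set, nonempty by the pigeonhole principle. So it is attained infinitely often and
  bounds all late priorities.\<close>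

lemma play_prio_Infinite_limsup:
  assumes "finite (range (\<lambda>n. prio G (\<rho> n)))"
  obtains N where "infinite {n. prio G (\<rho> n) = play_prio G (Infinite \<rho>)}"
    and "\<And>n. N \<le> n \<Longrightarrow> prio G (\<rho> n) \<le> play_prio G (Infinite \<rho>)"
proof -
  let ?f = "\<lambda>n. prio G (\<rho> n)"
  define K where "K = {k. infinite {n. ?f n = k}}"
  have sub: "K \<subseteq> range ?f"
  proof
    fix k assume "k \<in> K"
    then have "{n. ?f n = k} \<noteq> {}" unfolding K_def by fastforce
    then show "k \<in> range ?f" by auto
  qed
  then have fin: "finite K" using assms finite_subset by blast
  obtain n0 where "infinite {n. ?f n = ?f n0}"
    using pigeonhole_infinite[OF infinite_UNIV_nat assms] by auto
  then have "K \<noteq> {}" unfolding K_def by blast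
  then have inf: "Max K \<in> K" using fin by (rule Max_in[rotated])
  \<comment> \<open>The priorities outside \<open>K\<close> are finitely many and each occurs
    finitely often, so one bound lies beyond all their occurrences.\<close>
  have "finite (\<Union>k\<in>range ?f - K. {n. ?f n = k})"
    using assms by (auto simp: K_def)
  then obtain B where B: "\<And>n. n \<in> (\<Union>k\<in>range ?f - K. {n. ?f n = k}) \<Longrightarrow> n < B"
    unfolding finite_nat_set_iff_bounded by blast
  have "?f n \<le> Max K" if "B \<le> n" for n
  proof -
    have "?f n \<in> K" using B[of n] that by auto
    then show ?thesis using fin by simp
  qed
  with inf show ?thesis by (intro that[of B]) (auto simp: K_def)
qed

lemma infinite_shift_iff:
  "infinite {n. P (n + m)} \<longleftrightarrow> infinite {n::nat. P n}"
proof -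
  have "{n. P n} = {n. n < m \<and> P n} \<union> (\<lambda>n. n + m) ` {n. P (n + m)}"
  proof (intro equalityI subsetI)
    fix n assume n: "n \<in> {n. P n}"
    show "n \<in> {n. n < m \<and> P n} \<union> (\<lambda>n. n + m) ` {n. P (n + m)}"
    proof (cases "n < m")
      case False
      then have "n = (n - m) + m" by simp
      then show ?thesis using n by (intro UnI2 rev_image_eqI[of "n - m"]) auto
    qed (use n in simp)
  qed auto
  moreover have "finite {n. n < m \<and> P n}" by simp
  moreover have "finite ((\<lambda>n. n + m) ` {n. P (n + m)}) \<longleftrightarrow> finite {n. P (n + m)}"
    by (rule finite_image_iff) simp
  ultimately show ?thesis by simp
qed

text \<open>Prefix independence: it carries the parity of a suffix inside \<open>D\<^sub>0\<close>
  over to the whole play.\<close>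

lemma play_prio_Infinite_shift:
  "play_prio G (Infinite (\<lambda>n. \<rho> (n + m))) = play_prio G (Infinite \<rho>)"
  by (simp add: infinite_shift_iff[of "\<lambda>n. prio G (\<rho> n) = k" m for k])

section \<open>Coherent plays\<close>

text \<open>The assumption \<open>nontrivial\<close> separates \<open>D_zero\<close> from
  \<open>D_bot\<close>; the one-element order is treated apart in the final theorem.\<close>

locale simple_qd_measure =
  fixes G :: "'v parity_game"
    and M :: "('m :: {linorder, order_bot, order_top}, 'v) measure_ops"
    and \<mu> :: "'v \<Rightarrow> 'm"
  assumes game: "is_parity_game G"
    and space: "regress_measure_space G M"
    and canonical: "canonical_truncation G M"
    and trunc_bot: "\<And>v. v \<in> pos G \<Longrightarrow> odd (prio G v) \<Longrightarrow> trunc M bot v = bot"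
    and simple: "simple_measure_function G M \<mu>"
    and qdm: "quasi_dominion_measure G M \<mu>"
    and nontrivial: "(bot :: 'm) \<noteq> top"
begin

abbreviation "D\<^sub>0 \<equiv> D_zero G M \<mu>"
abbreviation "D\<^sub>p \<equiv> D_plus G M \<mu>"

lemma D_zero_subset_D_plus: "D\<^sub>0 \<subseteq> D\<^sub>p"
  using nontrivial by (auto simp: D_zero_def D_plus_def D_bot_def)

lemma D_plus_subset_pos: "D\<^sub>p \<subseteq> pos G"
  by (auto simp: D_plus_def)

section \<open>Truncated measures along a play\<close>

lemma trunc_mono:
  assumes "u \<in> pos G" "\<eta> \<le> \<eta>'"
  shows "trunc M \<eta> u \<le> trunc M \<eta>' u"
  using canonical assms unfolding canonical_truncation_def by (auto dest: monoD)

lemma trunc_eq_top_iff: "u \<in> pos G \<Longrightarrow> trunc M \<eta> u = top \<longleftrightarrow> \<eta> = top"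
  using canonical unfolding canonical_truncation_def by blast

lemma trunc_stretch_le:
  "\<lbrakk>v \<in> pos G; u \<in> pos G; odd (prio G u); prio G v \<le> prio G u\<rbrakk>
    \<Longrightarrow> trunc M (stretch M \<eta> v) u \<le> trunc M \<eta> u"
  using space unfolding regress_measure_space_def by blast

lemma trunc_stretch_less:
  "\<lbrakk>v \<in> pos G; odd (prio G v); bot < trunc M \<eta> v; trunc M \<eta> v < top\<rbrakk>
    \<Longrightarrow> trunc M (stretch M \<eta> v) v < trunc M \<eta> v"
  using space unfolding regress_measure_space_def by blast

text \<open>A nonempty simple path from \<open>w\<close> inside \<open>D\<^sub>p\<close> would put
  \<open>w\<close> there, and the value \<open>top\<close> would put it in \<open>D\<^sub>0\<close>.
  Membership in \<open>D_bot\<close> alone only fixes the truncation at \<open>w\<close>; the full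
  value is needed to truncate at another position.\<close>

lemma exit_measure_bot:
  assumes "w \<in> pos G" "w \<notin> D\<^sub>p"
  shows "\<mu> w = bot"
proof -
  have "\<mu> w \<noteq> top"
    using assms D_zero_subset_D_plus trunc_eq_top_iff by (auto simp: D_zero_def)
  then obtain \<pi> where \<pi>: "\<pi> \<in> simple_paths G w D\<^sub>p" "\<mu> w = msr M \<pi>"
    using simple assms by (auto simp: simple_measure_function_def simple_measures_def)
  then have "\<pi> = []"
    using assms by (cases \<pi>) (auto simp: simple_paths_def)
  with \<pi> show ?thesis by simp
qed

text \<open>Each step joins monotonicity of truncation with the second regress condition. Nothing is
  asked of the endpoint \<open>\<rho> n\<close>, which may therefore be an exit position.\<close>

lemma trunc_le_along:
  assumes u: "u \<in> pos G" "odd (prio G u)" and "m \<le> n"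
    and "\<And>i. m \<le> i \<Longrightarrow> i < n \<Longrightarrow>
      \<rho> i \<in> pos G \<and> prio G (\<rho> i) \<le> prio G u \<and> \<mu> (\<rho> i) \<le> stretch M (\<mu> (\<rho> (Suc i))) (\<rho> i)"
  shows "trunc M (\<mu> (\<rho> m)) u \<le> trunc M (\<mu> (\<rho> n)) u"
  using assms(3,4)
proof (induction n rule: dec_induct)
  case (step n)
  then have "trunc M (\<mu> (\<rho> m)) u \<le> trunc M (\<mu> (\<rho> n)) u" by simp
  also have "\<dots> \<le> trunc M (stretch M (\<mu> (\<rho> (Suc n))) (\<rho> n)) u"
    using step u by (intro trunc_mono) auto
  also have "\<dots> \<le> trunc M (\<mu> (\<rho> (Suc n))) u"
    using step u by (intro trunc_stretch_le) auto
  finally show ?case .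
qed simp

text \<open>The first regress condition is strict only strictly between \<open>bot\<close> and
  \<open>top\<close>. The value \<open>bot\<close> is excluded by \<open>u\<close> being in
  \<open>D\<^sub>p\<close>; \<open>top\<close> by \<open>u'\<close> lying outside
  \<open>D\<^sub>0\<close>, since canonicity makes truncation to \<open>top\<close> independent of
  the position.\<close>

lemma trunc_less_step:
  assumes "u \<in> D\<^sub>p" "odd (prio G u)" "u' \<in> pos G" "u' \<notin> D\<^sub>0"
    and le: "\<mu> u \<le> stretch M (\<mu> u') u"
  shows "trunc M (\<mu> u) u < trunc M (\<mu> u') u"
proof -
  have u: "u \<in> pos G" using assms D_plus_subset_pos by auto
  have 1: "trunc M (\<mu> u) u \<le> trunc M (stretch M (\<mu> u') u) u"
    using u le by (rule trunc_mono)
  also have "\<dots> \<le> trunc M (\<mu> u') u"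
    using u assms by (intro trunc_stretch_le) auto
  finally have "trunc M (\<mu> u') u \<noteq> bot"
    using assms(1) by (auto simp: D_plus_def D_bot_def bot_unique)
  moreover have "trunc M (\<mu> u') u \<noteq> top"
    using assms(3,4) u trunc_eq_top_iff by (auto simp: D_zero_def)
  ultimately have "trunc M (stretch M (\<mu> u') u) u < trunc M (\<mu> u') u"
    using u assms(2) by (intro trunc_stretch_less) (auto simp: bot.not_eq_extremum top.not_eq_extremum)
  with 1 show ?thesis by simp
qed

section \<open>Parity of infinite and of exiting plays\<close>

lemma infinite_play_even:
  assumes in_D: "\<And>n. \<rho> n \<in> D\<^sub>p - D\<^sub>0"
    and le: "\<And>n. \<mu> (\<rho> n) \<le> stretch M (\<mu> (\<rho> (Suc n))) (\<rho> n)"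
  shows "even (play_prio G (Infinite \<rho>))"
proof (rule ccontr)
  let ?k = "play_prio G (Infinite \<rho>)"
  assume odd: "odd ?k"
  have pos: "\<rho> n \<in> pos G" for n using in_D D_plus_subset_pos by blast
  have fin: "finite (pos G)" using game by (simp add: is_parity_game_def pos_def)
  have "finite (range (\<lambda>n. prio G (\<rho> n)))"
    by (rule finite_subset[of _ "prio G ` pos G"]) (use pos fin in auto)
  from play_prio_Infinite_limsup[OF this] obtain N where N: "infinite {n. prio G (\<rho> n) = ?k}"
      "\<And>n. N \<le> n \<Longrightarrow> prio G (\<rho> n) \<le> ?k"
    by blast
  \<comment> \<open>A second pigeonhole passes from a recurring priority to a single recurring
    position, visited at two times \<open>m < n\<close> beyond \<open>N\<close>.\<close>
  have "finite (\<rho> ` {n. prio G (\<rho> n) = ?k})"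
    by (rule finite_subset[OF _ fin]) (use pos in auto)
  then obtain n0 where n0: "prio G (\<rho> n0) = ?k"
      and inf: "infinite {n \<in> {n. prio G (\<rho> n) = ?k}. \<rho> n = \<rho> n0}"
    using pigeonhole_infinite[OF N(1)] by blast
  obtain m where m: "N < m" "\<rho> m = \<rho> n0"
    using inf unfolding infinite_nat_iff_unbounded by blast
  obtain n where n: "m < n" "\<rho> n = \<rho> n0"
    using inf unfolding infinite_nat_iff_unbounded by blast
  let ?u = "\<rho> n0"
  \<comment> \<open>Leaving \<open>?u\<close> is a strict increase and the way back to
    \<open>?u\<close> never decreases, so its truncated measure would exceed itself.\<close>
  have "trunc M (\<mu> ?u) ?u < trunc M (\<mu> (\<rho> (Suc m))) ?u"
    using in_D[of n0] le[of m] m odd n0 in_D[of "Suc m"] pos by (intro trunc_less_step) auto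
  also have "\<dots> \<le> trunc M (\<mu> (\<rho> n)) ?u"
    using pos odd n0 m n le N(2) by (intro trunc_le_along) auto
  finally show False using n by simp
qed

lemma finite_play_even:
  assumes in_D: "\<And>i. i < n \<Longrightarrow> \<rho> i \<in> D\<^sub>p" and "0 < n"
    and le: "\<And>i. i < n \<Longrightarrow> \<mu> (\<rho> i) \<le> stretch M (\<mu> (\<rho> (Suc i))) (\<rho> i)"
    and exit: "\<rho> n \<in> pos G" "\<rho> n \<notin> D\<^sub>p"
  shows "even (play_prio G (Finite (map \<rho> [0..<n])))"
proof (rule ccontr)
  let ?k = "play_prio G (Finite (map \<rho> [0..<n]))"
  assume odd: "odd ?k"
  \<comment> \<open>Positivity of \<open>n\<close> keeps the set nonempty, so the maximum is
    attained.\<close>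
  have "?k \<in> prio G ` set (map \<rho> [0..<n])"
    unfolding play_prio.simps by (rule Max_in) (use \<open>0 < n\<close> in auto)
  then obtain j where j: "j < n" "prio G (\<rho> j) = ?k" by auto
  have max: "prio G (\<rho> i) \<le> ?k" if "i < n" for i
    using that by (auto intro!: Max_ge)
  have pos: "\<rho> i \<in> pos G" if "i < n" for i using in_D[OF that] D_plus_subset_pos by blast
  have "trunc M (\<mu> (\<rho> j)) (\<rho> j) \<le> trunc M (\<mu> (\<rho> n)) (\<rho> j)"
    using j odd pos max le by (intro trunc_le_along) auto
  also have "\<dots> = bot"
    using exit_measure_bot[OF exit] trunc_bot[of "\<rho> j"] pos[of j] j odd by simp
  finally show False
    using in_D[OF j(1)] by (auto simp: D_plus_def D_bot_def bot_unique)
qed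

section \<open>Construction of witnesses\<close>

text \<open>Asking for coherence only outside \<open>D\<^sub>0\<close> lets the criterion cover both
  a glued strategy and the restriction of a coherent one.\<close>

lemma quasi_dominion0_witnessI:
  assumes strat: "\<sigma> \<in> strategies0 G D\<^sub>p"
    and win: "dominion0_witness G D\<^sub>0 (restrict0 G \<sigma> D\<^sub>0)"
    and coh: "\<And>v. v \<in> D\<^sub>p - D\<^sub>0 \<Longrightarrow> v \<in> pos0 G \<Longrightarrow> \<mu> v \<le> stretch M (\<mu> (\<sigma> v)) v"
  shows "quasi_dominion0_witness G D\<^sub>p \<sigma>"
  unfolding quasi_dominion0_witness_def
proof (intro conjI ballI strat)
  fix \<tau> v assume \<tau>: "\<tau> \<in> strategies1 G D\<^sub>p" and v: "v \<in> D\<^sub>p"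
  let ?s = "next_pos G \<sigma> \<tau>"
  define \<rho> where "\<rho> n = (?s ^^ n) v" for n
  have \<rho>_Suc: "\<rho> (Suc n) = ?s (\<rho> n)" for n by (simp add: \<rho>_def)
  have move: "?s x \<in> succs G x" if "x \<in> D\<^sub>p" for x
    using that strat \<tau> D_plus_subset_pos
    by (auto simp: next_pos_def strategies0_def strategies1_def pos_def)
  then have s_pos: "?s x \<in> pos G" if "x \<in> D\<^sub>p" for x
    using that game by (fastforce simp: is_parity_game_def succs_def)
  have le: "\<mu> x \<le> stretch M (\<mu> (?s x)) x" if x: "x \<in> D\<^sub>p - D\<^sub>0" for x
  proof (cases "x \<in> pos0 G")
    case True
    then show ?thesis using coh[OF x] by (simp add: next_pos_def)
  next
    case False
    then have "x \<in> pos1 G" using x D_plus_subset_pos by (auto simp: pos_def)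
    then show ?thesis
      using qdm x move[of x] by (auto simp: quasi_dominion_measure_def regress_measure_def)
  qed
  have play_eq: "play_in G D\<^sub>p \<sigma> \<tau> v = (if \<forall>n. \<rho> n \<in> D\<^sub>p then Infinite \<rho>
      else Finite (map \<rho> [0..<(LEAST n. \<rho> n \<notin> D\<^sub>p)]))"
    by (simp add: play_in_def Let_def flip: \<rho>_def)
  \<comment> \<open>Both strategies are cut down to \<open>D\<^sub>0\<close>, as extensionality
    demands. The resulting play \<open>r\<close> stays there, where the cut does not alter moves, so
    it is the suffix of \<open>\<rho>\<close> from \<open>m\<close>.\<close>
  have win': "(\<forall>n. \<rho> (n + m) \<in> D\<^sub>0) \<and> even (play_prio G (Infinite \<rho>))" if m: "\<rho> m \<in> D\<^sub>0" for m
  proof -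
    let ?s' = "next_pos G (restrict0 G \<sigma> D\<^sub>0) (restrict \<tau> (D\<^sub>0 \<inter> pos1 G))"
    define r where "r n = (?s' ^^ n) (\<rho> m)" for n
    have "restrict \<tau> (D\<^sub>0 \<inter> pos1 G) \<in> strategies1 G D\<^sub>0"
      using \<tau> D_zero_subset_D_plus by (auto simp: strategies1_def)
    then have w: "is_infinite (play_in G D\<^sub>0 (restrict0 G \<sigma> D\<^sub>0) (restrict \<tau> (D\<^sub>0 \<inter> pos1 G)) (\<rho> m))"
        "even (play_prio G (play_in G D\<^sub>0 (restrict0 G \<sigma> D\<^sub>0) (restrict \<tau> (D\<^sub>0 \<inter> pos1 G)) (\<rho> m)))"
      using win m by (auto simp: dominion0_witness_def)
    then have in_D0: "r n \<in> D\<^sub>0" for n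
      by (auto simp: play_in_def Let_def r_def split: if_splits)
    then have even_r: "even (play_prio G (Infinite r))"
      using w(2) by (simp add: play_in_def Let_def r_def[abs_def])
    have agree: "?s' x = ?s x" if "x \<in> D\<^sub>0" for x
      using that D_zero_subset_D_plus D_plus_subset_pos
      by (auto simp: next_pos_def restrict0_def pos_def)
    have "r n = \<rho> (n + m)" for n
    proof (induction n)
      case (Suc n)
      have "r (Suc n) = ?s' (r n)" by (simp add: r_def)
      also have "\<dots> = ?s (r n)" using in_D0 by (rule agree)
      finally show ?case using Suc by (simp add: \<rho>_Suc)
    qed (simp add: r_def)
    then have "r = (\<lambda>n. \<rho> (n + m))" by blast
    then show ?thesis
      using even_r in_D0 play_prio_Infinite_shift[of G \<rho> m] by metis
  qed
  show "even (play_prio G (play_in G D\<^sub>p \<sigma> \<tau> v))"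
  proof (cases "\<forall>n. \<rho> n \<in> D\<^sub>p")
    case True
    show ?thesis
    proof (cases "\<exists>m. \<rho> m \<in> D\<^sub>0")
      case True
      then show ?thesis using win' play_eq \<open>\<forall>n. \<rho> n \<in> D\<^sub>p\<close> by auto
    next
      case False
      then have "even (play_prio G (Infinite \<rho>))"
        using True le by (intro infinite_play_even) (auto simp: \<rho>_Suc)
      then show ?thesis using play_eq True by simp
    qed
  next
    case False
    define n where "n = (LEAST n. \<rho> n \<notin> D\<^sub>p)"
    have exit: "\<rho> n \<notin> D\<^sub>p" unfolding n_def using False by (metis (mono_tags, lifting) LeastI)
    have before: "\<rho> i \<in> D\<^sub>p" if "i < n" for i
      using that not_less_Least unfolding n_def by blast
    \<comment> \<open>The exit position thus has a predecessor in \<open>D\<^sub>p\<close>, whose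
      move is legal; this places the exit in \<open>pos G\<close>.\<close>
    have "n \<noteq> 0" using exit v by (auto simp: \<rho>_def intro: gr0I)
    then obtain l where l: "n = Suc l" by (cases n) auto
    \<comment> \<open>A visit to \<open>D\<^sub>0\<close> would trap the play inside
      \<open>D\<^sub>p\<close> and preclude the exit.\<close>
    have not_zero: "\<rho> i \<notin> D\<^sub>0" if "i < n" for i
    proof
      assume "\<rho> i \<in> D\<^sub>0"
      then have "\<rho> ((n - i) + i) \<in> D\<^sub>0" using win' by blast
      then show False using that exit D_zero_subset_D_plus by auto
    qed
    have "even (play_prio G (Finite (map \<rho> [0..<n])))"
    proof (rule finite_play_even)
      show "\<rho> n \<in> pos G" using s_pos before[of l] by (simp add: l \<rho>_Suc)
    qed (use before le not_zero exit \<open>n \<noteq> 0\<close> in \<open>auto simp: \<rho>_Suc\<close>)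
    then show ?thesis using play_eq False by (simp add: n_def)
  qed
qed

text \<open>The witness glues a winning strategy on \<open>D\<^sub>0\<close> to successors chosen by
  the regress inequality elsewhere.\<close>

lemma quasi_dominion0_D_plus: "quasi_dominion0 G D\<^sub>p"
proof -
  obtain \<sigma>0 where \<sigma>0: "dominion0_witness G D\<^sub>0 \<sigma>0"
    using qdm by (auto simp: quasi_dominion_measure_def dominion0_def)
  \<comment> \<open>The guard sits below the existential so that choice yields a total function
    \<open>f\<close>.\<close>
  have "\<forall>v. \<exists>w. v \<in> D\<^sub>p - D\<^sub>0 \<and> v \<in> pos0 G \<longrightarrow> w \<in> succs G v \<and> \<mu> v \<le> stretch M (\<mu> w) v"
    using qdm by (fastforce simp: quasi_dominion_measure_def regress_measure_def)
  then obtain f where f: "\<And>v. v \<in> D\<^sub>p - D\<^sub>0 \<Longrightarrow> v \<in> pos0 G \<Longrightarrow>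
      f v \<in> succs G v \<and> \<mu> v \<le> stretch M (\<mu> (f v)) v"
    by metis
  define \<sigma> where "\<sigma> = restrict (\<lambda>v. if v \<in> D\<^sub>0 then \<sigma>0 v else f v) (D\<^sub>p \<inter> pos0 G)"
  have \<sigma>0s: "\<sigma>0 \<in> strategies0 G D\<^sub>0" using \<sigma>0 by (simp add: dominion0_witness_def)
  then have "restrict0 G \<sigma> D\<^sub>0 = \<sigma>0"
    using D_zero_subset_D_plus
    by (auto simp: restrict0_def \<sigma>_def strategies0_def restrict_def PiE_def extensional_def fun_eq_iff)
  moreover have "\<sigma> \<in> strategies0 G D\<^sub>p"
    using f \<sigma>0s by (auto simp: \<sigma>_def strategies0_def)
  ultimately have "quasi_dominion0_witness G D\<^sub>p \<sigma>"
    using \<sigma>0 f by (intro quasi_dominion0_witnessI) (auto simp: \<sigma>_def)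
  then show ?thesis using D_plus_subset_pos by (auto simp: quasi_dominion0_def)
qed

lemma coherent_winning_is_witness:
  assumes "\<sigma> \<in> strategies0 G (pos G)" "coherent G M \<mu> \<sigma>" "winning0_on G \<sigma> D\<^sub>0"
  shows "quasi_dominion0_witness G D\<^sub>p (restrict0 G \<sigma> D\<^sub>p)"
proof (rule quasi_dominion0_witnessI)
  show "restrict0 G \<sigma> D\<^sub>p \<in> strategies0 G D\<^sub>p"
    using assms(1) D_plus_subset_pos by (auto simp: restrict0_def strategies0_def)
  have "restrict0 G (restrict0 G \<sigma> D\<^sub>p) D\<^sub>0 = restrict0 G \<sigma> D\<^sub>0"
    using D_zero_subset_D_plus by (auto simp: restrict0_def restrict_def fun_eq_iff)
  then show "dominion0_witness G D\<^sub>0 (restrict0 G (restrict0 G \<sigma> D\<^sub>p) D\<^sub>0)"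
    using assms(3) by (simp add: winning0_on_def)
qed (use assms(2) in \<open>auto simp: restrict0_def coherent_def\<close>)

end

theorem theorem19:
  fixes G :: "'v parity_game"
    and M :: "('m :: {linorder, order_bot, order_top}, 'v) measure_ops"
    and \<mu> :: "'v \<Rightarrow> 'm"
  assumes "is_parity_game G"
    and "regress_measure_space G M"
    and "canonical_truncation G M"
    and "\<forall>v\<in>pos G. odd (prio G v) \<longrightarrow> trunc M bot v = bot"
    and "simple_measure_function G M \<mu>"
    and "quasi_dominion_measure G M \<mu>"
  shows "quasi_dominion0 G (D_plus G M \<mu>) \<and>
    (\<forall>\<sigma>\<in>strategies0 G (pos G). coherent G M \<mu> \<sigma> \<and> winning0_on G \<sigma> (D_zero G M \<mu>) \<longrightarrow>
       quasi_dominion0_witness G (D_plus G M \<mu>) (restrict0 G \<sigma> (D_plus G M \<mu>)))"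
proof (cases "(bot :: 'm) = top")
  case True
  \<comment> \<open>With a single measure every position is in \<open>D_bot\<close>, so both claims
    concern the empty set.\<close>
  have "x = bot" for x :: 'm by (metis True bot_unique top_greatest)
  then have "D_plus G M \<mu> = {}" by (auto simp: D_plus_def D_bot_def)
  then show ?thesis
    by (auto simp: quasi_dominion0_def quasi_dominion0_witness_def strategies0_def restrict0_def)
next
  case False
  with assms interpret simple_qd_measure G M \<mu> by unfold_locales auto
  show ?thesis using quasi_dominion0_D_plus coherent_winning_is_witness by blast
qed

end
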